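(* Consider the receding horizon planning (RHP) scheme described in the context. Assume that the nominal trajectory $(\bar{\bm x}_{-1}(\cdot),\bar{\bm u}_{-1}(\cdot))$, with terminal time $\bar t_f^{-1}$, is feasible in the full horizon optimal control problem (P). Then the result at the end of each RHP iteration $k$ satisfying $t_k+T\le\bar t_f^{k-1}$ is a full horizon open-loop control law $\bar{\bm u}_k(\cdot)$ that is feasible in (P) and satisfies $$J_{\rm tot}(\bm x_0,\bar{\bm u}_k(\cdot))\le J_{\rm tot}(\bm x_0,\bar{\bm u}_{k-1}(\cdot))\le\dots\le J_{\rm tot}(\bm x_0,\bar{\bm u}_{-1}(\cdot)).$$
   Context: **System and full horizon problem (P).** Let $f:\mathbb R^n\times\mathbb R^m\to\mathbb R^n$, $\mathcal X\subseteq\mathbb R^n$, $\mathcal U\subseteq\mathbb R^m$, $\mathcal X_{\rm obst}\subset\mathbb R^n$, $\mathcal X_{\rm free}=\mathcal X\setminus\mathcal X_{\rm obst}$, initial time $t_0$, initial state $\bm x_0\in\mathcal X_{\rm free}$, terminal state $\bm x_f\in\mathcal X_{\rm free}$, and a cost function $\ell:\mathbb R^n\times\mathbb R^m\to\mathbb R$. Problem (P) is: minimize over control trajectories $\bm u(\cdot)$ and terminal times $t_f$ the functional $$J_{\rm tot}(\bm x_0,\bm u(\cdot))=\int_{t_0}^{t_f}\ell(\bm x(t),\bm u(t))\,\mathrm dt$$ subject to $\bm x(t_0)=\bm x_0$, $\bm x(t_f)=\bm x_f$, $\dot{\bm x}(t)=f(\bm x(t),\bm u(t))$, $\bm x(t)\in\mathcal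 X_{\rm free}$, $\bm u(t)\in\mathcal U$ for $t\in[t_0,t_f]$. A control/state trajectory with its terminal time is feasible in (P) if it satisfies these constraints. For the control $\bar{\bm u}_k(\cdot)$ below, $J_{\rm tot}(\bm x_0,\bar{\bm u}_k(\cdot))$ is evaluated with state trajectory $\bar{\bm x}_k(\cdot)$ and terminal time $\bar t_f^k$. **RHP scheme.** A nominal trajectory $(\bar{\bm x}_{-1}(\cdot),\bar{\bm u}_{-1}(\cdot))$ on $[t_0,\bar t_f^{-1}]$ is given, satisfying $\bar{\bm x}_{-1}(\tau)=\bm x_0+\int_{t_0}^{\tau}f(\bar{\bm x}_{-1}(t),\bar{\bm u}_{-1}(t))\,\mathrm dt$. Fix $\delta>0$ and a horizon length $T\in(\delta,T_{\max}]$, and put $t_k=t_0+k\delta$, $k=0,1,2,\dots$. RHP iterations $k=0,1,2,\dots$ are performed as long as $t_k+T\le\bar t_f^{k-1}$. At iteration $k$, given $(\bar{\bm x}_{k-1},\bar{\bm u}_{k-1},\bar t_f^{k-1})$, define the cost-to-go function $$\Psi_k(\tau)=\int_{\tau}^{\bar t_f^{k-1}}\ell(\bar{\bm x}_{k-1}(t),\bar{\bm u}_{k-1}(t))\,\mathrm dt,\qquad \tau\in[t_0,\bar t_f^{k-1}],$$ and solve the RHP problem: minimize over $\bm u_k(\cdot)$ on $[t_k,t_k+T]$ and $\tau_k\in[t_0,\bar t_f^{k-1}]$ $$J(\bar{\bm x}_{k-1}(t_k),\bm u_k(\cdot),\tau_k)=\Psi_k(\tau_k)+\int_{t_k}^{t_k+T}\ell(\bm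 x_k(t),\bm u_k(t))\,\mathrm dt$$ subject to $\bm x_k(t_k)=\bar{\bm x}_{k-1}(t_k)$, $\bm x_k(t_k+T)=\bar{\bm x}_{k-1}(\tau_k)$, $\dot{\bm x}_k(t)=f(\bm x_k(t),\bm u_k(t))$, $\bm x_k(t)\in\mathcal X_{\rm free}$, $\bm u_k(t)\in\mathcal U$ for $t\in[t_k,t_k+T]$. Let $(\bm u_k^\star(\cdot),\tau_k^\star)$ be an optimal solution of this RHP problem (assumed to exist), and set $\Delta t_k=\tau_k^\star-(t_k+T)$, $\bar t_f^{k}=\bar t_f^{k-1}-\Delta t_k$, and $$\bar{\bm u}_k(t)=\begin{cases}\bar{\bm u}_{k-1}(t), & t\in[t_0,t_k),\\ \bm u_k^\star(t), & t\in[t_k,t_k+T),\\ \bar{\bm u}_{k-1}(t+\Delta t_k), & t\in[t_k+T,\bar t_f^{k-1}-\Delta t_k],\end{cases}$$ with $\bar{\bm x}_k(\cdot)$ defined analogously (using the optimal state trajectory $\bm x_k^\star$ on $[t_k,t_k+T)$). *)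

theory Defs
  imports "HOL-Analysis.Analysis"
begin

record ('n, 'm) ocp =
  dyn :: "real ^ 'n \<Rightarrow> real ^ 'm \<Rightarrow> real ^ 'n"
  running_cost :: "real ^ 'n \<Rightarrow> real ^ 'm \<Rightarrow> real"
  X_set :: "(real ^ 'n) set"
  X_obst :: "(real ^ 'n) set"
  U_set :: "(real ^ 'm) set"
  t_init :: real
  x_init :: "real ^ 'n"
  x_final :: "real ^ 'n"

definition X_free :: "('n::finite, 'm::finite) ocp \<Rightarrow> (real ^ 'n) set" where
  "X_free P = X_set P - X_obst P"

(* State and control are total functions of time; only their values between the initial
   time of the problem and t_final are meaningful. *)
record ('n, 'm) trajectory =
  state :: "real \<Rightarrow> real ^ 'n"
  control :: "real \<Rightarrow> real ^ 'm"
  t_final :: real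

(* The differential equation is understood in the integral (Caratheodory) sense, since
   controls glued together from several pieces may jump. Under absolute integrability the
   gauge integral is the Lebesgue integral. *)
definition solves_dynamics ::
  "('n::finite, 'm::finite) ocp \<Rightarrow> (real \<Rightarrow> real ^ 'n) \<Rightarrow> (real \<Rightarrow> real ^ 'm) \<Rightarrow> real \<Rightarrow> real \<Rightarrow> bool" where
  "solves_dynamics P x u a b \<longleftrightarrow>
     (\<lambda>t. dyn P (x t) (u t)) absolutely_integrable_on {a..b} \<and>
     (\<forall>s\<in>{a..b}. x s = x a + integral {a..s} (\<lambda>t. dyn P (x t) (u t)))"

definition admissible ::
  "('n::finite, 'm::finite) ocp \<Rightarrow> (real \<Rightarrow> real ^ 'n) \<Rightarrow> (real \<Rightarrow> real ^ 'm) \<Rightarrow> real \<Rightarrow> real \<Rightarrow> bool" where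
  "admissible P x u a b \<longleftrightarrow>
     solves_dynamics P x u a b \<and> (\<forall>t\<in>{a..b}. x t \<in> X_free P \<and> u t \<in> U_set P)"

(* The value is infinite where the integral of the running cost does not exist; a real-valued
   integral would give such trajectories the cost 0. *)
definition cost ::
  "('n::finite, 'm::finite) ocp \<Rightarrow> (real \<Rightarrow> real ^ 'n) \<Rightarrow> (real \<Rightarrow> real ^ 'm) \<Rightarrow> real \<Rightarrow> real \<Rightarrow> ereal" where
  "cost P x u a b =
     (if (\<lambda>t. running_cost P (x t) (u t)) absolutely_integrable_on {a..b}
      then ereal (integral {a..b} (\<lambda>t. running_cost P (x t) (u t))) else \<infinity>)"

definition feasible :: "('n::finite, 'm::finite) ocp \<Rightarrow> ('n, 'm) trajectory \<Rightarrow> bool" where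
  "feasible P Z \<longleftrightarrow>
     t_init P \<le> t_final Z \<and>
     state Z (t_init P) = x_init P \<and> state Z (t_final Z) = x_final P \<and>
     admissible P (state Z) (control Z) (t_init P) (t_final Z)"

definition J_tot :: "('n::finite, 'm::finite) ocp \<Rightarrow> ('n, 'm) trajectory \<Rightarrow> ereal" where
  "J_tot P Z = cost P (state Z) (control Z) (t_init P) (t_final Z)"

definition cost_to_go :: "('n::finite, 'm::finite) ocp \<Rightarrow> ('n, 'm) trajectory \<Rightarrow> real \<Rightarrow> ereal" where
  "cost_to_go P Z \<tau> = cost P (state Z) (control Z) \<tau> (t_final Z)"

(* Z is the current nominal trajectory and s the start of the horizon of length T. The state x
   is listed along with u because the dynamics need not have unique solutions. *)
definition rhp_feasible ::
  "('n::finite, 'm::finite) ocp \<Rightarrow> ('n, 'm) trajectory \<Rightarrow> real \<Rightarrow> real \<Rightarrow>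
    (real \<Rightarrow> real ^ 'n) \<Rightarrow> (real \<Rightarrow> real ^ 'm) \<Rightarrow> real \<Rightarrow> bool" where
  "rhp_feasible P Z s T x u \<tau> \<longleftrightarrow>
     \<tau> \<in> {t_init P..t_final Z} \<and>
     x s = state Z s \<and> x (s + T) = state Z \<tau> \<and> admissible P x u s (s + T)"

definition rhp_cost ::
  "('n::finite, 'm::finite) ocp \<Rightarrow> ('n, 'm) trajectory \<Rightarrow> real \<Rightarrow> real \<Rightarrow>
    (real \<Rightarrow> real ^ 'n) \<Rightarrow> (real \<Rightarrow> real ^ 'm) \<Rightarrow> real \<Rightarrow> ereal" where
  "rhp_cost P Z s T x u \<tau> = cost_to_go P Z \<tau> + cost P x u s (s + T)"

definition rhp_optimal ::
  "('n::finite, 'm::finite) ocp \<Rightarrow> ('n, 'm) trajectory \<Rightarrow> real \<Rightarrow> real \<Rightarrow>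
    (real \<Rightarrow> real ^ 'n) \<Rightarrow> (real \<Rightarrow> real ^ 'm) \<Rightarrow> real \<Rightarrow> bool" where
  "rhp_optimal P Z s T x u \<tau> \<longleftrightarrow>
     rhp_feasible P Z s T x u \<tau> \<and>
     (\<forall>x' u' \<tau>'. rhp_feasible P Z s T x' u' \<tau>' \<longrightarrow>
        rhp_cost P Z s T x u \<tau> \<le> rhp_cost P Z s T x' u' \<tau>')"

definition splice ::
  "real \<Rightarrow> real \<Rightarrow> real \<Rightarrow> (real \<Rightarrow> 'a) \<Rightarrow> (real \<Rightarrow> 'a) \<Rightarrow> real \<Rightarrow> 'a" where
  "splice s T \<Delta> old new t =
     (if t < s then old t else if t < s + T then new t else old (t + \<Delta>))"

definition rhp_update ::
  "('n::finite, 'm::finite) trajectory \<Rightarrow> real \<Rightarrow> real \<Rightarrow>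
    (real \<Rightarrow> real ^ 'n) \<Rightarrow> (real \<Rightarrow> real ^ 'm) \<Rightarrow> real \<Rightarrow> ('n, 'm) trajectory" where
  "rhp_update Z s T x u \<tau> =
     (let \<Delta> = \<tau> - (s + T) in
      \<lparr>state = splice s T \<Delta> (state Z) x,
       control = splice s T \<Delta> (control Z) u,
       t_final = t_final Z - \<Delta>\<rparr>)"

definition t_iter :: "('n::finite, 'm::finite) ocp \<Rightarrow> real \<Rightarrow> nat \<Rightarrow> real" where
  "t_iter P \<delta> k = t_init P + real k * \<delta>"

(* Indices are shifted by one: Z 0 is the nominal trajectory given initially (index -1 in the
   usual notation), and iteration k turns Z k into Z (Suc k). The scheme stops for good at the
   first k with t_iter P \<delta> k + T > t_final (Z k); later members of Z are irrelevant. *)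
definition rhp_performed ::
  "('n::finite, 'm::finite) ocp \<Rightarrow> real \<Rightarrow> real \<Rightarrow> (nat \<Rightarrow> ('n, 'm) trajectory) \<Rightarrow> nat \<Rightarrow> bool" where
  "rhp_performed P \<delta> T Z k \<longleftrightarrow> (\<forall>j\<le>k. t_iter P \<delta> j + T \<le> t_final (Z j))"

definition rhp_run ::
  "('n::finite, 'm::finite) ocp \<Rightarrow> real \<Rightarrow> real \<Rightarrow> (nat \<Rightarrow> ('n, 'm) trajectory) \<Rightarrow>
    (nat \<Rightarrow> real \<Rightarrow> real ^ 'n) \<Rightarrow> (nat \<Rightarrow> real \<Rightarrow> real ^ 'm) \<Rightarrow> (nat \<Rightarrow> real) \<Rightarrow> bool" where
  "rhp_run P \<delta> T Z x u \<tau> \<longleftrightarrow>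
     (\<forall>k. rhp_performed P \<delta> T Z k \<longrightarrow>
        rhp_optimal P (Z k) (t_iter P \<delta> k) T (x k) (u k) (\<tau> k) \<and>
        Z (Suc k) = rhp_update (Z k) (t_iter P \<delta> k) T (x k) (u k) (\<tau> k))"

end

(* Both the state equation and the cost are additive over concatenation of time intervals and
   invariant under time shifts, so splicing the optimal segment into the current trajectory
   preserves feasibility and leaves the cost before the horizon and the cost-to-go after \<tau>
   unchanged. The current trajectory restricted to [s, s + T], with \<tau> = s + T, competes in the
   RHP problem, and its RHP cost is the cost of the current trajectory from s on; optimality
   therefore gives the descent. *)
theory Submission
  imports Defs
begin

section \<open>Additivity, time shifts and null sets for integrals and costs\<close>

lemma absolutely_integrable_on_combine_iff:
  fixes f :: "real \<Rightarrow> 'a::euclidean_space"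
  assumes "a \<le> b" "b \<le> c"
  shows "f absolutely_integrable_on {a..c} \<longleftrightarrow>
    f absolutely_integrable_on {a..b} \<and> f absolutely_integrable_on {b..c}"
  using assms absolutely_integrable_on_combine[of a b f c]
    absolutely_integrable_on_subinterval[of "{a..c}" f a b]
    absolutely_integrable_on_subinterval[of "{a..c}" f b c] by auto

lemma absolutely_integrable_shift_real_ivl_iff:
  fixes f :: "real \<Rightarrow> 'a::euclidean_space"
  shows "(\<lambda>t. f (t + d)) absolutely_integrable_on {a..b} \<longleftrightarrow>
    f absolutely_integrable_on {a + d..b + d}"
  unfolding absolutely_integrable_on_def
  using integrable_shift_real_ivl_iff[of f d "a + d" "b + d"]
    integrable_shift_real_ivl_iff[of "\<lambda>t. norm (f t)" d "a + d" "b + d"] by simp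

lemma integral_combine_absolutely:
  fixes f :: "real \<Rightarrow> 'a::euclidean_space"
  assumes "f absolutely_integrable_on {a..c}" "a \<le> b" "b \<le> c"
  shows "integral {a..c} f = integral {a..b} f + integral {b..c} f"
  using Henstock_Kurzweil_Integration.integral_combine[of a b c f] assms
    set_lebesgue_integral_eq_integral(1)[OF assms(1)] by simp

text \<open>Integrability on the whole interval is equivalent to integrability on both pieces, so
  infinite values match as well. As \<open>cost\<close> is never -\<infinity>, no indeterminate
  \<open>ereal\<close> sum arises.\<close>

lemma cost_combine:
  assumes "a \<le> b" "b \<le> c"
  shows "cost P x u a c = cost P x u a b + cost P x u b c"
  using integral_combine_absolutely[OF _ assms, of "\<lambda>t. running_cost P (x t) (u t)"]
    absolutely_integrable_on_combine_iff[OF assms, of "\<lambda>t. running_cost P (x t) (u t)"]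
  by (auto simp: cost_def)

lemma cost_shift:
  "cost P (\<lambda>t. x (t + d)) (\<lambda>t. u (t + d)) a b = cost P x u (a + d) (b + d)"
  using absolutely_integrable_shift_real_ivl_iff
      [of a b "\<lambda>t. running_cost P (x t) (u t)" d]
    integral_shift_real_ivl[of "a + d" d "b + d" "\<lambda>t. running_cost P (x t) (u t)"]
  by (simp add: cost_def)

text \<open>The right end point is a null set. It is left out because \<open>splice\<close> works
  with half-open pieces: at the end of a piece it already takes the value of the next one.\<close>

lemma cost_cong:
  assumes "\<And>t. a \<le> t \<Longrightarrow> t < b \<Longrightarrow> x t = y t" "\<And>t. a \<le> t \<Longrightarrow> t < b \<Longrightarrow> u t = v t"
  shows "cost P x u a b = cost P y v a b"
proof -
  let ?f = "\<lambda>t. running_cost P (x t) (u t)" and ?g = "\<lambda>t. running_cost P (y t) (v t)"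
  have eq: "?g t = ?f t" if "t \<in> {a..b} - {b}" for t
    using assms that by auto
  have "?f absolutely_integrable_on {a..b} \<longleftrightarrow> ?g absolutely_integrable_on {a..b}"
    by (rule absolutely_integrable_spike_eq[of "{b}"]) (use eq in auto)
  moreover have "integral {a..b} ?f = integral {a..b} ?g"
    by (rule integral_spike[of "{b}"]) (use eq in auto)
  ultimately show ?thesis
    by (simp add: cost_def)
qed

section \<open>Concatenation, shift and modification of admissible trajectories\<close>

lemma solves_dynamicsD:
  assumes "solves_dynamics P x u a b"
  shows "(\<lambda>t. dyn P (x t) (u t)) absolutely_integrable_on {a..b}"
    and "\<And>s. a \<le> s \<Longrightarrow> s \<le> b \<Longrightarrow> x s = x a + integral {a..s} (\<lambda>t. dyn P (x t) (u t))"
  using assms unfolding solves_dynamics_def by (blast, meson atLeastAtMost_iff)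

lemma solves_dynamicsI:
  assumes "(\<lambda>t. dyn P (x t) (u t)) absolutely_integrable_on {a..b}"
    and "\<And>s. a \<le> s \<Longrightarrow> s \<le> b \<Longrightarrow> x s = x a + integral {a..s} (\<lambda>t. dyn P (x t) (u t))"
  shows "solves_dynamics P x u a b"
  using assms unfolding solves_dynamics_def by (meson atLeastAtMost_iff)

lemma solves_dynamics_combine:
  assumes "a \<le> b" "b \<le> c"
  shows "solves_dynamics P x u a c \<longleftrightarrow> solves_dynamics P x u a b \<and> solves_dynamics P x u b c"
proof -
  let ?f = "\<lambda>t. dyn P (x t) (u t)"
  \<comment> \<open>The upper limit \<open>s\<close> varies because the integral equation must hold
    at every intermediate time. Both directions use this identity to trade the integral over
    \<open>{a..b}\<close> for \<open>x b - x a\<close>.\<close>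
  have split: "integral {a..s} ?f = integral {a..b} ?f + integral {b..s} ?f"
    if "?f absolutely_integrable_on {a..c}" "b \<le> s" "s \<le> c" for s
  proof (rule integral_combine_absolutely)
    show "?f absolutely_integrable_on {a..s}"
      using that by (intro absolutely_integrable_on_subinterval[OF that(1)]) simp
  qed (use assms that in auto)
  note ai_iff = absolutely_integrable_on_combine_iff[OF assms, of ?f]
  show ?thesis
  proof (intro iffI conjI)
    assume L: "solves_dynamics P x u a c"
    note ai = solves_dynamicsD(1)[OF L]
    show "solves_dynamics P x u a b"
    proof (rule solves_dynamicsI)
      show "?f absolutely_integrable_on {a..b}"
        using ai ai_iff by blast
      show "x s = x a + integral {a..s} ?f" if "a \<le> s" "s \<le> b" for s
        by (rule solves_dynamicsD(2)[OF L]) (use that assms in auto)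
    qed
    show "solves_dynamics P x u b c"
    proof (rule solves_dynamicsI)
      show "?f absolutely_integrable_on {b..c}"
        using ai ai_iff by blast
      show "x s = x b + integral {b..s} ?f" if s: "b \<le> s" "s \<le> c" for s
      proof -
        have xs: "x s = x a + integral {a..s} ?f"
          by (rule solves_dynamicsD(2)[OF L]) (use s assms in auto)
        have xb: "x b = x a + integral {a..b} ?f"
          by (rule solves_dynamicsD(2)[OF L]) (use assms in auto)
        show ?thesis
          by (simp only: xs xb split[OF ai s] add.assoc)
      qed
    qed
  next
    assume "solves_dynamics P x u a b \<and> solves_dynamics P x u b c"
    then have ab: "solves_dynamics P x u a b" and bc: "solves_dynamics P x u b c"
      by auto
    have ai: "?f absolutely_integrable_on {a..c}"
      using ai_iff solves_dynamicsD(1)[OF ab] solves_dynamicsD(1)[OF bc] by blast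
    show "solves_dynamics P x u a c"
    proof (rule solves_dynamicsI[OF ai])
      fix s assume s: "a \<le> s" "s \<le> c"
      show "x s = x a + integral {a..s} ?f"
      proof (cases "s \<le> b")
        case True
        with s show ?thesis by (intro solves_dynamicsD(2)[OF ab])
      next
        case False
        then have xs: "x s = x b + integral {b..s} ?f"
          using s by (intro solves_dynamicsD(2)[OF bc]) auto
        have xb: "x b = x a + integral {a..b} ?f"
          using assms by (intro solves_dynamicsD(2)[OF ab]) auto
        have "integral {a..s} ?f = integral {a..b} ?f + integral {b..s} ?f"
          using s False by (intro split[OF ai]) auto
        then show ?thesis
          by (simp only: xs xb add.assoc)
      qed
    qed
  qed
qed

lemma admissible_combine:
  assumes "a \<le> b" "b \<le> c"
  shows "admissible P x u a c \<longleftrightarrow> admissible P x u a b \<and> admissible P x u b c"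
proof -
  have "{a..c} = {a..b} \<union> {b..c}"
    using assms by auto
  then show ?thesis
    by (auto simp: admissible_def solves_dynamics_combine[OF assms])
qed

text \<open>The problem is autonomous: \<open>dyn\<close>, \<open>X_free\<close> and
  \<open>U_set\<close> do not depend on time, so only the integration variable has to be
  translated.\<close>

lemma admissible_shift:
  assumes "admissible P x u (a + d) (b + d)"
  shows "admissible P (\<lambda>t. x (t + d)) (\<lambda>t. u (t + d)) a b"
proof -
  let ?f = "\<lambda>t. dyn P (x t) (u t)"
  have sol: "solves_dynamics P x u (a + d) (b + d)"
    using assms by (simp add: admissible_def)
  have "solves_dynamics P (\<lambda>t. x (t + d)) (\<lambda>t. u (t + d)) a b"
  proof (rule solves_dynamicsI)
    show "(\<lambda>t. ?f (t + d)) absolutely_integrable_on {a..b}"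
      using solves_dynamicsD(1)[OF sol] absolutely_integrable_shift_real_ivl_iff[of a b ?f d]
      by blast
    show "x (s + d) = x (a + d) + integral {a..s} (\<lambda>t. ?f (t + d))" if "a \<le> s" "s \<le> b" for s
      using solves_dynamicsD(2)[OF sol, of "s + d"] that
        integral_shift_real_ivl[of "a + d" d "s + d" ?f] by simp
  qed
  then show ?thesis
    using assms by (simp add: admissible_def)
qed

(* At the right end point the two controls may differ, as happens at a splicing point. *)
lemma admissible_cong:
  assumes adm: "admissible P x u a b"
    and x: "\<And>t. a \<le> t \<Longrightarrow> t \<le> b \<Longrightarrow> y t = x t"
    and u: "\<And>t. a \<le> t \<Longrightarrow> t < b \<Longrightarrow> v t = u t"
    and b: "v b \<in> U_set P"
  shows "admissible P y v a b"
proof -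
  let ?f = "\<lambda>t. dyn P (x t) (u t)" and ?g = "\<lambda>t. dyn P (y t) (v t)"
  have sol: "solves_dynamics P x u a b"
    using adm by (simp add: admissible_def)
  have eq: "?g t = ?f t" if "t \<in> {a..b} - {b}" for t
    using x u that by auto
  have "solves_dynamics P y v a b"
  proof (rule solves_dynamicsI)
    show "?g absolutely_integrable_on {a..b}"
      by (rule absolutely_integrable_spike[OF solves_dynamicsD(1)[OF sol], of "{b}"])
        (use eq in auto)
    show "y s = y a + integral {a..s} ?g" if s: "a \<le> s" "s \<le> b" for s
    proof -
      have "integral {a..s} ?f = integral {a..s} ?g"
        by (rule integral_spike[of "{b}"]) (use eq s in auto)
      then show ?thesis
        using solves_dynamicsD(2)[OF sol s] x[of s] x[of a] s by simp
    qed
  qed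
  moreover have "y t \<in> X_free P \<and> v t \<in> U_set P" if "t \<in> {a..b}" for t
    using adm x[of t] u[of t] b that by (cases "t = b") (auto simp: admissible_def)
  ultimately show ?thesis
    by (simp add: admissible_def)
qed

section \<open>A single RHP iteration starting at an arbitrary time\<close>

context
  fixes P :: "('n::finite, 'm::finite) ocp" and Z :: "('n, 'm) trajectory"
    and s T \<tau> :: real and x :: "real \<Rightarrow> real ^ 'n" and u :: "real \<Rightarrow> real ^ 'm"
  assumes feas: "feasible P Z" and s: "t_init P \<le> s" and T: "0 < T"
begin

text \<open>Each of the three pieces is admissible on its own, and the RHP boundary conditions make
  the states agree at \<open>s\<close> and \<open>s + T\<close>, so the pieces can be concatenated.
  The reconnection time \<open>\<tau>\<close> may lie anywhere on the old trajectory, even before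
  \<open>s\<close>.\<close>

lemma feasible_rhp_update:
  assumes "rhp_feasible P Z s T x u \<tau>" "s \<le> t_final Z"
  shows "feasible P (rhp_update Z s T x u \<tau>)"
proof -
  define Y where "Y = rhp_update Z s T x u \<tau>"
  define d where "d = \<tau> - (s + T)"
  have st: "state Y = splice s T d (state Z) x" and ct: "control Y = splice s T d (control Z) u"
    and tf: "t_final Y = t_final Z - d"
    by (simp_all add: Y_def rhp_update_def Let_def d_def)
  have \<tau>: "t_init P \<le> \<tau>" "\<tau> \<le> t_final Z" and xs: "x s = state Z s" "x (s + T) = state Z \<tau>"
    and adm: "admissible P x u s (s + T)"
    using assms(1) by (auto simp: rhp_feasible_def)
  \<comment> \<open>The third piece has the length \<open>t_final Z - \<tau>\<close> of the old
    tail; it may be a single point.\<close>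
  have le: "s + T \<le> t_final Y"
    using \<tau> by (simp add: tf d_def)
  have admZ: "admissible P (state Z) (control Z) (t_init P) (t_final Z)"
    using feas by (simp add: feasible_def)
  \<comment> \<open>These are the values of the spliced control at the junctions
    \<open>s + T\<close> and \<open>s\<close>, which \<open>admissible_cong\<close> asks for at the
    right ends of the second and first piece.\<close>
  have U: "control Z \<tau> \<in> U_set P" "u s \<in> U_set P"
    using admZ adm \<tau> T by (auto simp: admissible_def)
  have "admissible P (state Y) (control Y) (t_init P) s"
    by (rule admissible_cong[of P "state Z" "control Z"])
      (use admZ admissible_combine[OF s assms(2)] xs U T in \<open>auto simp: st ct splice_def\<close>)
  moreover have "admissible P (state Y) (control Y) s (s + T)"
    by (rule admissible_cong[OF adm])
      (use xs U T in \<open>auto simp: st ct splice_def d_def\<close>)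
  \<comment> \<open>Translation by \<open>d\<close> carries this interval to
    \<open>{\<tau>..t_final Z}\<close>, the retained tail of the old trajectory.\<close>
  moreover have "admissible P (state Y) (control Y) (s + T) (t_final Y)"
  proof (rule admissible_cong)
    have "admissible P (state Z) (control Z) \<tau> (t_final Z)"
      using admZ admissible_combine[OF \<tau>] by blast
    then show "admissible P (\<lambda>t. state Z (t + d)) (\<lambda>t. control Z (t + d)) (s + T) (t_final Y)"
      by (intro admissible_shift) (simp add: tf d_def)
    show "control Y (t_final Y) \<in> U_set P"
      using admZ \<tau> le T by (auto simp: ct splice_def tf admissible_def)
  qed (use T in \<open>auto simp: st ct splice_def\<close>)
  ultimately have "admissible P (state Y) (control Y) (t_init P) (t_final Y)"
    using s T le admissible_combine[of s "s + T" "t_final Y" P "state Y" "control Y"]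
      admissible_combine[of "t_init P" s "t_final Y" P "state Y" "control Y"] by simp
  \<comment> \<open>If the horizon starts at the initial time, \<open>splice\<close> reads the
    initial state from \<open>x\<close>, and \<open>x s = state Z s\<close> is what identifies
    it.\<close>
  moreover have "state Y (t_init P) = x_init P"
    using feas s xs T by (cases "t_init P = s") (auto simp: st splice_def feasible_def)
  moreover have "state Y (t_final Y) = x_final P"
    using feas le T by (simp add: st splice_def tf feasible_def)
  ultimately show ?thesis
    using s T le by (simp add: feasible_def flip: Y_def)
qed

text \<open>The cost before \<open>s\<close> does not depend on \<open>x\<close>, \<open>u\<close>
  or \<open>\<tau>\<close>, so comparing RHP costs amounts to comparing total costs up to a common
  summand.\<close>

lemma J_tot_rhp_update:
  assumes "\<tau> \<le> t_final Z"
  shows "J_tot P (rhp_update Z s T x u \<tau>) =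
    cost P (state Z) (control Z) (t_init P) s + rhp_cost P Z s T x u \<tau>"
proof -
  define Y where "Y = rhp_update Z s T x u \<tau>"
  define d where "d = \<tau> - (s + T)"
  have st: "state Y = splice s T d (state Z) x" and ct: "control Y = splice s T d (control Z) u"
    and tf: "t_final Y = t_final Z - d"
    by (simp_all add: Y_def rhp_update_def Let_def d_def)
  have le: "s + T \<le> t_final Y"
    using assms by (simp add: tf d_def)
  have "cost P (state Y) (control Y) (t_init P) s = cost P (state Z) (control Z) (t_init P) s"
    by (rule cost_cong) (auto simp: st ct splice_def)
  moreover have "cost P (state Y) (control Y) s (s + T) = cost P x u s (s + T)"
    by (rule cost_cong) (auto simp: st ct splice_def)
  moreover have "cost P (state Y) (control Y) (s + T) (t_final Y) =
      cost P (\<lambda>t. state Z (t + d)) (\<lambda>t. control Z (t + d)) (s + T) (t_final Y)"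
    by (rule cost_cong) (use T in \<open>auto simp: st ct splice_def\<close>)
  then have "cost P (state Y) (control Y) (s + T) (t_final Y) = cost_to_go P Z \<tau>"
    by (simp add: cost_shift cost_to_go_def tf d_def)
  moreover have "J_tot P Y = cost P (state Y) (control Y) (t_init P) s +
      (cost P (state Y) (control Y) s (s + T) + cost P (state Y) (control Y) (s + T) (t_final Y))"
    using s T le cost_combine[of s "s + T" "t_final Y" P "state Y" "control Y"]
      cost_combine[of "t_init P" s "t_final Y" P "state Y" "control Y"]
    by (simp add: J_tot_def)
  ultimately show ?thesis
    by (simp add: rhp_cost_def add.commute flip: Y_def)
qed

text \<open>Reconnecting at \<open>\<tau> = s + T\<close> means zero time shift. The condition for
  performing the iteration is what puts this \<open>\<tau>\<close> in the allowed range.\<close>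

lemma rhp_feasible_current:
  assumes "s + T \<le> t_final Z"
  shows "rhp_feasible P Z s T (state Z) (control Z) (s + T)"
proof -
  have "admissible P (state Z) (control Z) (t_init P) (t_final Z)"
    using feas by (simp add: feasible_def)
  then have "admissible P (state Z) (control Z) s (s + T)"
    using s T assms admissible_combine[of s "s + T" "t_final Z" P "state Z" "control Z"]
      admissible_combine[of "t_init P" s "t_final Z" P "state Z" "control Z"] by simp
  then show ?thesis
    using s T assms by (simp add: rhp_feasible_def)
qed

lemma J_tot_current:
  assumes "s + T \<le> t_final Z"
  shows "J_tot P Z = cost P (state Z) (control Z) (t_init P) s +
    rhp_cost P Z s T (state Z) (control Z) (s + T)"
  using s T assms
    cost_combine[of s "s + T" "t_final Z" P "state Z" "control Z"]
    cost_combine[of "t_init P" s "t_final Z" P "state Z" "control Z"]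
  by (simp add: J_tot_def rhp_cost_def cost_to_go_def add.commute)

lemma J_tot_rhp_update_le:
  assumes "rhp_optimal P Z s T x u \<tau>" "s + T \<le> t_final Z"
  shows "J_tot P (rhp_update Z s T x u \<tau>) \<le> J_tot P Z"
proof -
  have "\<tau> \<le> t_final Z"
    using assms(1) by (simp add: rhp_optimal_def rhp_feasible_def)
  moreover have "rhp_cost P Z s T x u \<tau> \<le> rhp_cost P Z s T (state Z) (control Z) (s + T)"
    using assms(1) rhp_feasible_current[OF assms(2)] by (simp add: rhp_optimal_def)
  \<comment> \<open>The common summand is only added, never cancelled, so the argument also covers
    infinite costs.\<close>
  ultimately show ?thesis
    by (simp add: J_tot_rhp_update J_tot_current[OF assms(2)] add_left_mono)
qed

end

theorem theorem1:
  fixes P :: "('n::finite, 'm::finite) ocp"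
    and \<delta> T T_max :: real
    and Z :: "nat \<Rightarrow> ('n, 'm) trajectory"
    and x_opt :: "nat \<Rightarrow> real \<Rightarrow> real ^ 'n"
    and u_opt :: "nat \<Rightarrow> real \<Rightarrow> real ^ 'm"
    and \<tau>_opt :: "nat \<Rightarrow> real"
    and k :: nat
  assumes "x_init P \<in> X_free P" and "x_final P \<in> X_free P"
    and "\<delta> > 0" and "T \<in> {\<delta><..T_max}"
    and "rhp_run P \<delta> T Z x_opt u_opt \<tau>_opt"
    and "feasible P (Z 0)"
    and "rhp_performed P \<delta> T Z k"
  shows "feasible P (Z (Suc k)) \<and> (\<forall>j\<le>k. J_tot P (Z (Suc j)) \<le> J_tot P (Z j))"
proof -
  have T: "0 < T" and start: "t_init P \<le> t_iter P \<delta> j" for j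
    using assms(3,4) by (auto simp: t_iter_def)
  \<comment> \<open>Descent at \<open>j\<close> relies on feasibility of \<open>Z j\<close>, since
    the current trajectory must be a competitor; feasibility is therefore what the induction carries
    along.\<close>
  have step: "feasible P (Z (Suc j)) \<and> J_tot P (Z (Suc j)) \<le> J_tot P (Z j)"
    if "j \<le> k" "feasible P (Z j)" for j
  proof -
    have perf: "rhp_performed P \<delta> T Z j" and le: "t_iter P \<delta> j + T \<le> t_final (Z j)"
      using assms(7) that(1) by (auto simp: rhp_performed_def)
    then have opt: "rhp_optimal P (Z j) (t_iter P \<delta> j) T (x_opt j) (u_opt j) (\<tau>_opt j)"
      and upd: "Z (Suc j) = rhp_update (Z j) (t_iter P \<delta> j) T (x_opt j) (u_opt j) (\<tau>_opt j)"
      using assms(5) by (auto simp: rhp_run_def)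
    from opt have "feasible P (Z (Suc j))"
      unfolding upd using le T
      by (intro feasible_rhp_update[OF that(2) start T]) (auto simp: rhp_optimal_def)
    moreover have "J_tot P (Z (Suc j)) \<le> J_tot P (Z j)"
      unfolding upd by (rule J_tot_rhp_update_le[OF that(2) start T opt le])
    ultimately show ?thesis ..
  qed
  \<comment> \<open>The range reaches \<open>Suc k\<close> because iteration \<open>k\<close>
    produces \<open>Z (Suc k)\<close>; each inductive step uses only an iteration with index at most
    \<open>k\<close>.\<close>
  have "feasible P (Z j)" if "j \<le> Suc k" for j
    using that by (induction j) (use assms(6) step in auto)
  with step show ?thesis
    by auto
qed

end
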